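(* Let $\mathcal A$ be a finite alphabet, $X=\mathcal A^{\mathbb N}$, and let $g=e^f$, $g(x)=g_0\prod_{i=1}^\infty g_i(x_i)$, be a balanced potential function. (1) The Ruelle operator $\mathcal L_f$ defines canonically a bounded linear operator on $L^p(X,\rho)$ for all $1\le p\le\infty$, where $\rho=\otimes_{i=1}^\infty\rho_0$ is any stationary Bernoulli measure. (2) Assume that $g$ has $\ell_2$-summable tails, that is, for some $k>1$, $$\sum_{i=k}^\infty\max_{a\in\mathcal A}\Big(\sum_{j=i}^\infty\log g_j(a)\Big)^2<\infty,$$ and that $\rho=\otimes_{i=1}^\infty\rho_0$ is a stationary Bernoulli measure with $$\int\log g_k(x_k)\,\rho(dx)=\sum_{a\in\mathcal A}\rho_0(a)\log g_k(a)=0\qquad\forall k\ge1.$$ Then the function $h:X\to\mathbb R_+\cup\{\infty\}$ defined by $$h((x_i)_{i\in\mathbb N})=\prod_{i=1}^\infty h_i(x_i),\qquad h_i(a)=\prod_{k>i}g_k(a),\ a\in\mathcal A,$$ belongs to $L^p(X,\rho)$ for every $1\le p<\infty$ and is an almost surely positive eigenfunction of $\mathcal L_f:L^p(X,\rho)\to L^p(X,\rho)$ with eigenvalue $$\lambda=g_0\sum_{a\in\mathcal A}\prod_{k=1}^\infty g_k(a).$$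
   Context: $X=\mathcal A^{\mathbb N}$ carries the product topology and its Borel $\sigma$-algebra; $T(x_1,x_2,\ldots)=(x_2,x_3,\ldots)$. The Ruelle operator is $\mathcal L_f\phi(x)=\sum_{T(y)=x}\phi(y)e^{f(y)}=\sum_{a\in\mathcal A}\phi(ax)g(ax)$, where $ax=(a,x_1,x_2,\ldots)$. "Defines canonically an operator on $L^p(X,\rho)$" means that this pointwise formula passes to $\rho$-equivalence classes of functions. A balanced potential is a positive function of the form $g(x)=g_0\prod_{i\ge1}g_i(x_i)$ with a constant $g_0>0$ and $g_i:\mathcal A\to(0,\infty)$ such that $\sum_i\log g_i(x_i)$ converges for all $x\in X$ and $\prod_{a\in\mathcal A}g_i(a)=1$ for all $i\ge1$. A stationary Bernoulli measure is a product measure $\rho=\otimes_{i=1}^\infty\rho_0$ with all factors equal to one probability measure $\rho_0$ on $\mathcal A$.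
   Formalization: In (1), ρ_0 is assumed to give every letter positive mass; if ρ_0(a)=0, the indicator of {y_1=a} is 0 almost everywhere but its image under L_f is positive everywhere, so (1) fails. In (2), the product defining h is shown to converge almost surely. *)

theory Defs
  imports "HOL-Probability.Probability"
begin

(* Points of X are functions nat => 'a and all indices start at 0: the coordinate x_i of the
   mathematical text is x (i - 1), and the factor g_i (i >= 1) is gs (i - 1). The constant g_0
   is the separate parameter g0. The scalars of the L^p spaces range over a complete normed
   field 'k over the reals, so that the real and the complex L^p spaces are both covered. *)

definition shift :: "(nat \<Rightarrow> 'a) \<Rightarrow> nat \<Rightarrow> 'a" where
  "shift x = (\<lambda>n. x (Suc n))"

definition ruelle_operator ::
  "((nat \<Rightarrow> 'a) \<Rightarrow> real) \<Rightarrow> ((nat \<Rightarrow> 'a) \<Rightarrow> 'k::real_normed_field) \<Rightarrow> (nat \<Rightarrow> 'a) \<Rightarrow> 'k" where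
  "ruelle_operator f \<phi> x = (\<Sum>y | shift y = x. \<phi> y * of_real (exp (f y)))"

lemma ruelle_operator_eq_sum_letters:
  fixes f :: "(nat \<Rightarrow> 'a::finite) \<Rightarrow> real"
  shows "ruelle_operator f \<phi> x =
    (\<Sum>a\<in>UNIV. \<phi> (case_nat a x) * of_real (exp (f (case_nat a x))))"
proof -
  have 1: "{y. shift y = x} = range (\<lambda>a. case_nat a x)"
  proof (intro set_eqI iffI)
    fix y assume "y \<in> {y. shift y = x}"
    then have "y = case_nat (y 0) x"
      by (auto simp: shift_def fun_eq_iff split: nat.splits)
    then show "y \<in> range (\<lambda>a. case_nat a x)" by blast
  qed (auto simp: shift_def)
  have 2: "inj (\<lambda>a. case_nat a x :: nat \<Rightarrow> 'a)"
    by (rule injI) (metis nat.case(1))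
  show ?thesis
    unfolding ruelle_operator_def 1 by (subst sum.reindex[OF 2]) simp
qed

definition balanced_potential ::
  "real \<Rightarrow> (nat \<Rightarrow> 'a::finite \<Rightarrow> real) \<Rightarrow> ((nat \<Rightarrow> 'a) \<Rightarrow> real) \<Rightarrow> bool" where
  "balanced_potential g0 gs g \<longleftrightarrow>
     g0 > 0 \<and> (\<forall>i a. gs i a > 0) \<and>
     (\<forall>x. summable (\<lambda>i. ln (gs i (x i)))) \<and>
     (\<forall>i. (\<Prod>a\<in>UNIV. gs i a) = 1) \<and>
     (\<forall>x. g x = g0 * (\<Prod>i. gs i (x i)))"

(* With indices starting at 0, k > 1 becomes k > 0. *)
definition l2_summable_tails :: "(nat \<Rightarrow> 'a::finite \<Rightarrow> real) \<Rightarrow> bool" where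
  "l2_summable_tails gs \<longleftrightarrow>
     (\<exists>k>0. summable (\<lambda>i. MAX a\<in>UNIV. (\<Sum>j. ln (gs (k + i + j) a))\<^sup>2))"

(* All subsets of the finite alphabet are measurable, so this lives on the product
   sigma-algebra, which is the Borel sigma-algebra of the product topology. If some letter a has
   mass 0, the indicator of {y. y 0 = a} vanishes almost everywhere while its image under the
   Ruelle operator is positive everywhere; the operator then does not act on classes of almost
   everywhere equal functions. *)
definition bernoulli_measure :: "'a pmf \<Rightarrow> (nat \<Rightarrow> 'a) measure" where
  "bernoulli_measure \<rho>0 = PiM UNIV (\<lambda>_. measure_pmf \<rho>0)"

(* The elements of L^p are handled through their representatives. *)
definition Lp_space ::
  "'b measure \<Rightarrow> ennreal \<Rightarrow> ('b \<Rightarrow> 'k::real_normed_field) set" where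
  "Lp_space M p = {\<phi> \<in> borel_measurable M.
     if p = \<infinity> then esssup M (\<lambda>x. ennreal (norm (\<phi> x))) < \<infinity>
     else integrable M (\<lambda>x. norm (\<phi> x) powr enn2real p)}"

definition Lp_norm ::
  "'b measure \<Rightarrow> ennreal \<Rightarrow> ('b \<Rightarrow> 'k::real_normed_field) \<Rightarrow> real" where
  "Lp_norm M p \<phi> =
     (if p = \<infinity> then enn2real (esssup M (\<lambda>x. ennreal (norm (\<phi> x))))
      else (\<integral>x. norm (\<phi> x) powr enn2real p \<partial>M) powr (1 / enn2real p))"

(* The second clause says that L passes to classes of almost everywhere equal functions. *)
definition defines_bounded_linear_operator_on_Lp ::
  "'b measure \<Rightarrow> ennreal \<Rightarrow> (('b \<Rightarrow> 'k::real_normed_field) \<Rightarrow> 'b \<Rightarrow> 'k) \<Rightarrow> bool" where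
  "defines_bounded_linear_operator_on_Lp M p L \<longleftrightarrow>
     (\<forall>\<phi>\<in>Lp_space M p. L \<phi> \<in> Lp_space M p) \<and>
     (\<forall>\<phi>\<in>Lp_space M p. \<forall>\<psi>\<in>Lp_space M p.
        (AE x in M. \<phi> x = \<psi> x) \<longrightarrow> (AE x in M. L \<phi> x = L \<psi> x)) \<and>
     (\<forall>\<phi>\<in>Lp_space M p. \<forall>\<psi>\<in>Lp_space M p.
        AE x in M. L (\<lambda>y. \<phi> y + \<psi> y) x = L \<phi> x + L \<psi> x) \<and>
     (\<forall>c. \<forall>\<phi>\<in>Lp_space M p. AE x in M. L (\<lambda>y. c * \<phi> y) x = c * L \<phi> x) \<and>
     (\<exists>C. \<forall>\<phi>\<in>Lp_space M p. Lp_norm M p (L \<phi>) \<le> C * Lp_norm M p \<phi>)"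

definition Lp_eigenfunction ::
  "'b measure \<Rightarrow> ennreal \<Rightarrow> (('b \<Rightarrow> 'k::real_normed_field) \<Rightarrow> 'b \<Rightarrow> 'k) \<Rightarrow> 'k \<Rightarrow> ('b \<Rightarrow> 'k) \<Rightarrow> bool"
  where
  "Lp_eigenfunction M p L c \<phi> \<longleftrightarrow>
     \<phi> \<in> Lp_space M p \<and> \<not> (AE x in M. \<phi> x = 0) \<and> (AE x in M. L \<phi> x = c * \<phi> x)"

definition h_factor :: "(nat \<Rightarrow> 'a \<Rightarrow> real) \<Rightarrow> nat \<Rightarrow> 'a \<Rightarrow> real" where
  "h_factor gs i a = (\<Prod>j. gs (Suc i + j) a)"

definition h_partial :: "(nat \<Rightarrow> 'a \<Rightarrow> real) \<Rightarrow> (nat \<Rightarrow> 'a) \<Rightarrow> nat \<Rightarrow> ennreal" where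
  "h_partial gs x n = (\<Prod>i<n. ennreal (h_factor gs i (x i)))"

(* The limit is taken in [0, \<infinity>], so that the values 0 and \<infinity> are allowed; prodinf would not
   admit them. Where the partial products have no limit in [0, \<infinity>] the value is unspecified. *)
definition h_fun :: "(nat \<Rightarrow> 'a \<Rightarrow> real) \<Rightarrow> (nat \<Rightarrow> 'a) \<Rightarrow> ennreal" where
  "h_fun gs x = lim (h_partial gs x)"

definition eigenvalue :: "real \<Rightarrow> (nat \<Rightarrow> 'a::finite \<Rightarrow> real) \<Rightarrow> real" where
  "eigenvalue g0 gs = g0 * (\<Sum>a\<in>UNIV. \<Prod>k. gs k a)"

end

theory Submission
  imports Defs
begin

text \<open>
  Convergence of the series of logarithms at every point forces
  $\sum_i \max_a |\log g_i(a)| < \infty$, so $g$ is bounded. The Ruelle operator is therefore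
  dominated by a finite sum of the maps $\phi \mapsto \phi(a\,\cdot)$, and each of these
  is bounded on $L^p$ because $\rho$ dominates $\rho_0(a)$ times its image under $x \mapsto ax$.

  Under the hypotheses of the second part, $\log h_i(x_i)$ are independent, centred and bounded by
  constants $c_i$ with $\sum_i c_i^2 < \infty$. Kolmogorov's theorem gives almost sure convergence of
  $\sum_i \log h_i(x_i)$, hence $0 < h < \infty$, and Hoeffding's lemma with Fatou's lemma bounds
  the $p$-th moment of $h$ by $\exp (p^2 \sum_i c_i^2 / 2)$. The eigenvalue equation
  is the telescoping identity $h_i = g_{i+1} h_{i+1}$ applied to each preimage $ax$.
\<close>

subsection \<open>Series of independent random variables\<close>

(* Freezing the partial sums once they reach absolute value e keeps the increments of a sum of
   independent centred variables orthogonal, and the final value remembers whether level e was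
   ever reached. *)
primrec stopped_sum :: "real \<Rightarrow> (nat \<Rightarrow> real) \<Rightarrow> nat \<Rightarrow> real" where
  "stopped_sum e u 0 = 0"
| "stopped_sum e u (Suc n) =
     stopped_sum e u n + (if \<bar>stopped_sum e u n\<bar> < e then u n else 0)"

lemma stopped_sum_eq_sum:
  assumes "\<bar>stopped_sum e u n\<bar> < e"
  shows "stopped_sum e u n = sum u {..<n}"
  using assms by (induction n) (auto split: if_splits)

lemma abs_stopped_sum_ge_mono:
  assumes "j \<le> n" "e \<le> \<bar>stopped_sum e u j\<bar>"
  shows "e \<le> \<bar>stopped_sum e u n\<bar>"
  using assms by (induction n rule: dec_induct) auto

text \<open>Either the stopped sum at time \<open>j\<close> is still below \<open>e\<close> and so
  agrees with the ordinary sum, which is impossible here, or it is already frozen at a level of at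
  least \<open>e\<close> and keeps it up to time \<open>n\<close>.\<close>

lemma abs_stopped_sum_ge:
  assumes "j \<le> n" "e \<le> \<bar>sum u {..<j}\<bar>"
  shows "e \<le> \<bar>stopped_sum e u n\<bar>"
  using assms abs_stopped_sum_ge_mono[OF assms(1), of e u] stopped_sum_eq_sum[of e u j]
  by (cases "\<bar>stopped_sum e u j\<bar> < e") auto

lemma stopped_sum_cong:
  assumes "\<And>i. i < n \<Longrightarrow> u i = v i"
  shows "stopped_sum e u n = stopped_sum e v n"
  using assms by (induction n) auto

lemma measurable_stopped_sum [measurable]:
  assumes "\<And>i. i < n \<Longrightarrow> (\<lambda>x. X x i) \<in> borel_measurable M"
  shows "(\<lambda>x. stopped_sum e (X x) n) \<in> borel_measurable M"
  using assms
proof (induction n)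
  case (Suc n)
  then have [measurable]: "(\<lambda>x. stopped_sum e (X x) n) \<in> borel_measurable M"
      "(\<lambda>x. X x n) \<in> borel_measurable M" by auto
  show ?case by simp
qed simp

context prob_space
begin

text \<open>Regroup the variables into the disjoint singleton blocks \<open>{f j}\<close> and
  project each block to its only coordinate. This lets the maximal inequality act on shifted
  sequences.\<close>

lemma indep_vars_reindex:
  assumes "indep_vars M' X I" and "inj_on f J" "f ` J \<subseteq> I"
  shows "indep_vars (\<lambda>j. M' (f j)) (\<lambda>j. X (f j)) J"
proof -
  have "indep_vars (\<lambda>j. PiM {f j} M') (\<lambda>j \<omega>. restrict (\<lambda>i. X i \<omega>) {f j}) J"
    using assms by (intro indep_vars_restrict[OF assms(1)]) (auto simp: disjoint_family_on_def inj_on_def)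
  then have "indep_vars (\<lambda>j. M' (f j)) (\<lambda>j \<omega>. (\<lambda>u. u (f j)) (restrict (\<lambda>i. X i \<omega>) {f j})) J"
    by (rule indep_vars_compose2) simp
  then show ?thesis by simp
qed

text \<open>The stopped sum at time \<open>n\<close> depends only on the block
  \<open>{..<n}\<close>, which is independent of the block \<open>{n}\<close>. The map
  \<open>F\<close> leaves room for the truncation in the second moment estimate.\<close>

lemma indep_var_stopped_sum:
  fixes X :: "nat \<Rightarrow> 'a \<Rightarrow> real"
  assumes "indep_vars (\<lambda>_. borel) X UNIV" and F [measurable]: "F \<in> borel_measurable borel"
  shows "indep_var borel (\<lambda>x. F (stopped_sum e (\<lambda>i. X i x) n)) borel (X n)"
proof -
  let ?Y = "\<lambda>u. F (stopped_sum e u n)"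
  have "indep_var (PiM {..<n} (\<lambda>_. borel)) (\<lambda>x. restrict (\<lambda>i. X i x) {..<n})
     (PiM {n} (\<lambda>_. borel)) (\<lambda>x. restrict (\<lambda>i. X i x) {n})"
    by (rule indep_var_restrict[OF assms(1)]) auto
  then have "indep_var borel (?Y \<circ> (\<lambda>x. restrict (\<lambda>i. X i x) {..<n}))
     borel ((\<lambda>u. u n) \<circ> (\<lambda>x. restrict (\<lambda>i. X i x) {n}))"
    by (rule indep_var_compose) (auto intro!: measurable_compose[OF _ F] measurable_stopped_sum)
  moreover have "stopped_sum e (restrict (\<lambda>i. X i x) {..<n}) n = stopped_sum e (\<lambda>i. X i x) n" for x
    by (rule stopped_sum_cong) auto
  ultimately show ?thesis by (simp add: comp_def)
qed

text \<open>Induction on \<open>n\<close>: the cross term in the expanded square is a product of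
  independent variables, one of them centred, so it integrates to 0. The new square counts only
  where the sum is not yet frozen.\<close>

lemma stopped_sum_second_moment:
  fixes X :: "nat \<Rightarrow> 'a \<Rightarrow> real"
  assumes indep: "indep_vars (\<lambda>_. borel) X UNIV"
    and sq: "\<And>i. integrable M (\<lambda>x. (X i x)\<^sup>2)"
    and mean: "\<And>i. expectation (X i) = 0"
  shows "integrable M (\<lambda>x. (stopped_sum e (\<lambda>i. X i x) n)\<^sup>2) \<and>
    expectation (\<lambda>x. (stopped_sum e (\<lambda>i. X i x) n)\<^sup>2) \<le> (\<Sum>i<n. expectation (\<lambda>x. (X i x)\<^sup>2))"
proof (induction n)
  case (Suc n)
  have X [measurable]: "X i \<in> borel_measurable M" for i
    using indep by (auto simp: indep_vars_def)
  define Z where "Z = (\<lambda>x. stopped_sum e (\<lambda>i. X i x) n)"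
  \<comment> \<open>\<open>W\<close> and \<open>U\<close> carry the stopping condition: one step
    adds \<open>2 * (W x * X n x) + U x\<close> to the square, and \<open>W\<close> is a function of
    the past alone.\<close>
  define W where "W = (\<lambda>x. if \<bar>Z x\<bar> < e then Z x else 0)"
  define U where "U = (\<lambda>x. if \<bar>Z x\<bar> < e then (X n x)\<^sup>2 else 0)"
  have [measurable]: "Z \<in> borel_measurable M" by (simp add: Z_def)
  have iZ: "integrable M (\<lambda>x. (Z x)\<^sup>2)"
    and EZ: "expectation (\<lambda>x. (Z x)\<^sup>2) \<le> (\<Sum>i<n. expectation (\<lambda>x. (X i x)\<^sup>2))"
    using Suc.IH by (auto simp: Z_def)
  have iX: "integrable M (X n)"
    by (rule square_integrable_imp_integrable[OF _ sq]) simp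
  have iW: "integrable M W"
    by (rule Bochner_Integration.integrable_bound[OF square_integrable_imp_integrable[OF _ iZ]])
      (auto simp: W_def)
  have "indep_var borel (\<lambda>x. (\<lambda>z. if \<bar>z\<bar> < e then z else 0) (Z x)) borel (X n)"
    unfolding Z_def by (rule indep_var_stopped_sum[OF indep]) measurable
  then have WX: "indep_var borel W borel (X n)" by (simp add: W_def)
  have iWX: "integrable M (\<lambda>x. W x * X n x)"
    and EWX: "expectation (\<lambda>x. W x * X n x) = 0"
    using indep_var_integrable[OF WX iW iX] indep_var_lebesgue_integral[OF WX iW iX] mean by auto
  have iU: "integrable M U"
    by (rule Bochner_Integration.integrable_bound[OF sq[of n]]) (auto simp: U_def)
  have EU: "expectation U \<le> expectation (\<lambda>x. (X n x)\<^sup>2)"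
    by (rule integral_mono[OF iU sq]) (auto simp: U_def)
  have eq: "(stopped_sum e (\<lambda>i. X i x) (Suc n))\<^sup>2 = (Z x)\<^sup>2 + 2 * (W x * X n x) + U x" for x
    by (auto simp: Z_def W_def U_def power2_eq_square algebra_simps)
  have i1: "integrable M (\<lambda>x. (Z x)\<^sup>2 + 2 * (W x * X n x))"
    using iZ iWX by auto
  have "expectation (\<lambda>x. (Z x)\<^sup>2 + 2 * (W x * X n x) + U x) = expectation (\<lambda>x. (Z x)\<^sup>2) + expectation U"
    using i1 iU iZ iWX EWX by simp
  then show ?case
    unfolding eq using EZ EU i1 iU by auto
qed simp

text \<open>If any partial sum up to \<open>n\<close> reaches level \<open>e\<close>, the stopped
  sum still shows it at time \<open>n\<close>. So Markov's inequality for the square of that single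
  variable suffices.\<close>

theorem kolmogorov_maximal_inequality:
  fixes X :: "nat \<Rightarrow> 'a \<Rightarrow> real"
  assumes indep: "indep_vars (\<lambda>_. borel) X UNIV"
    and sq: "\<And>i. integrable M (\<lambda>x. (X i x)\<^sup>2)"
    and mean: "\<And>i. expectation (X i) = 0"
    and e: "e > 0"
  shows "prob {x \<in> space M. \<exists>j\<le>n. e \<le> \<bar>\<Sum>i<j. X i x\<bar>} \<le> (\<Sum>i<n. expectation (\<lambda>x. (X i x)\<^sup>2)) / e\<^sup>2"
proof -
  have [measurable]: "X i \<in> borel_measurable M" for i
    using indep by (auto simp: indep_vars_def)
  let ?Z = "\<lambda>x. stopped_sum e (\<lambda>i. X i x) n"
  note Z = stopped_sum_second_moment[OF indep sq mean, of e n]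
  have "e\<^sup>2 \<le> (?Z x)\<^sup>2" if "j \<le> n" "e \<le> \<bar>\<Sum>i<j. X i x\<bar>" for x j
    using abs_stopped_sum_ge[OF that] e by (metis abs_le_square_iff abs_of_pos)
  then have "prob {x \<in> space M. \<exists>j\<le>n. e \<le> \<bar>\<Sum>i<j. X i x\<bar>} \<le> prob {x \<in> space M. e\<^sup>2 \<le> (?Z x)\<^sup>2}"
    by (intro finite_measure_mono) auto
  also have "\<dots> \<le> expectation (\<lambda>x. (?Z x)\<^sup>2) / e\<^sup>2"
    using Z e by (intro integral_Markov_inequality_measure[where A="{}"]) auto
  also have "\<dots> \<le> (\<Sum>i<n. expectation (\<lambda>x. (X i x)\<^sup>2)) / e\<^sup>2"
    using Z by (intro divide_right_mono) auto
  finally show ?thesis .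
qed

text \<open>Beyond a late index \<open>m\<close> little variance remains, so by the maximal
  inequality all blocks starting at \<open>m\<close> are small with high probability. Almost surely
  the partial sums are therefore Cauchy.\<close>

theorem kolmogorov_one_series:
  fixes X :: "nat \<Rightarrow> 'a \<Rightarrow> real"
  assumes indep: "indep_vars (\<lambda>_. borel) X UNIV"
    and sq: "\<And>i. integrable M (\<lambda>x. (X i x)\<^sup>2)"
    and mean: "\<And>i. expectation (X i) = 0"
    and var: "summable (\<lambda>i. expectation (\<lambda>x. (X i x)\<^sup>2))"
  shows "AE x in M. summable (\<lambda>i. X i x)"
proof -
  have [measurable]: "X i \<in> borel_measurable M" for i
    using indep by (auto simp: indep_vars_def)
  let ?v = "\<lambda>i. expectation (\<lambda>x. (X i x)\<^sup>2)"
  have tail: "prob {x \<in> space M. \<exists>j. e \<le> \<bar>\<Sum>i<j. X (i + m) x\<bar>} \<le> (\<Sum>i. ?v (i + m)) / e\<^sup>2"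
    if e: "e > 0" for e m
  proof -
    let ?A = "\<lambda>n. {x \<in> space M. \<exists>j\<le>n. e \<le> \<bar>\<Sum>i<j. X (i + m) x\<bar>}"
    \<comment> \<open>The events increase with \<open>n\<close>, so continuity from below extends
      the finite maximal inequality to blocks of every length.\<close>
    have "(\<lambda>n. prob (?A n)) \<longlonglongrightarrow> prob (\<Union>n. ?A n)"
      by (intro finite_Lim_measure_incseq) (auto simp: incseq_def intro: order_trans)
    also have "(\<Union>n. ?A n) = {x \<in> space M. \<exists>j. e \<le> \<bar>\<Sum>i<j. X (i + m) x\<bar>}" by auto
    finally have lim: "(\<lambda>n. prob (?A n)) \<longlonglongrightarrow> prob {x \<in> space M. \<exists>j. e \<le> \<bar>\<Sum>i<j. X (i + m) x\<bar>}" .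
    have "indep_vars (\<lambda>_. borel) (\<lambda>i. X (i + m)) UNIV"
      by (rule indep_vars_reindex[OF indep]) (auto simp: inj_on_def)
    then have "prob (?A n) \<le> (\<Sum>i<n. ?v (i + m)) / e\<^sup>2" for n
      using sq mean e by (intro kolmogorov_maximal_inequality)
    also have "(\<Sum>i<n. ?v (i + m)) / e\<^sup>2 \<le> (\<Sum>i. ?v (i + m)) / e\<^sup>2" for n
      by (intro divide_right_mono sum_le_suminf summable_ignore_initial_segment[OF var]) auto
    finally show ?thesis
      by (intro LIMSEQ_le_const2[OF lim]) auto
  qed
  have null: "AE x in M. \<exists>m. \<forall>j. \<bar>\<Sum>i<j. X (i + m) x\<bar> < e" if e: "e > 0" for e
  proof -
    define B where "B = {x \<in> space M. \<forall>m. \<exists>j. e \<le> \<bar>\<Sum>i<j. X (i + m) x\<bar>}"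
    have [measurable]: "B \<in> sets M" unfolding B_def by measurable
    \<comment> \<open>\<open>B\<close> lies in the tail event for every start \<open>m\<close>;
      choose \<open>m\<close> so late that the remaining variance is below
      \<open>r * e\<^sup>2\<close>.\<close>
    have "prob B \<le> r" if r: "r > 0" for r
    proof -
      obtain m where m: "norm (\<Sum>i. ?v (i + m)) < r * e\<^sup>2"
        using suminf_exist_split[OF _ var, of "r * e\<^sup>2"] r e by auto
      have "prob B \<le> prob {x \<in> space M. \<exists>j. e \<le> \<bar>\<Sum>i<j. X (i + m) x\<bar>}"
        unfolding B_def by (intro finite_measure_mono) auto
      also have "\<dots> \<le> (\<Sum>i. ?v (i + m)) / e\<^sup>2" by (rule tail[OF e])
      also have "\<dots> \<le> r"
        using m e by (subst pos_divide_le_eq) auto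
      finally show ?thesis .
    qed
    then have "prob B = 0"
      using field_le_epsilon[of "prob B" 0] by (simp add: measure_le_0_iff)
    then have "B \<in> null_sets M"
      by (intro null_setsI) (simp_all add: emeasure_eq_measure)
    from AE_not_in[OF this] AE_space show ?thesis
      by eventually_elim (simp add: B_def not_le)
  qed
  \<comment> \<open>Countably many levels suffice for the Cauchy criterion, and their exceptional
    null sets have a null union.\<close>
  have "AE x in M. \<forall>k. \<exists>m. \<forall>j. \<bar>\<Sum>i<j. X (i + m) x\<bar> < 1 / real (Suc k)"
    by (subst AE_all_countable) (auto intro!: null)
  then show ?thesis
  proof eventually_elim
    case (elim x)
    have blk: "sum (\<lambda>i. X i x) {m..<m + j} = (\<Sum>i<j. X (i + m) x)" for m j
      using sum.shift_bounds_nat_ivl[of "\<lambda>i. X i x" 0 m j] by (simp add: atLeast0LessThan add.commute)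
    show ?case
      unfolding summable_Cauchy
    proof (intro allI impI)
      fix r :: real assume "r > 0"
      then obtain k where k: "1 / real (Suc k) < r / 2" using nat_approx_posE[of "r/2"] by auto
      from elim obtain m where m: "\<And>j. \<bar>\<Sum>i<j. X (i + m) x\<bar> < 1 / real (Suc k)" by blast
      \<comment> \<open>The block from \<open>a\<close> to \<open>b\<close> is a difference of two
        blocks that start at \<open>m\<close>, each smaller than \<open>r / 2\<close>.\<close>
      have "norm (sum (\<lambda>i. X i x) {a..<b}) < r" if "a \<ge> m" for a b
      proof (cases "a \<le> b")
        case True
        then have "sum (\<lambda>i. X i x) {m..<a} + sum (\<lambda>i. X i x) {a..<b} = sum (\<lambda>i. X i x) {m..<b}"
          using that by (intro sum.atLeastLessThan_concat)
        moreover have "m + (a - m) = a" "m + (b - m) = b" using that True by auto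
        ultimately show ?thesis
          using m[of "a - m"] m[of "b - m"] k blk[of m "a - m"] blk[of m "b - m"]
          unfolding real_norm_def by (smt (verit) field_sum_of_halves)
      qed (use \<open>r > 0\<close> in auto)
      then show "\<exists>N. \<forall>m\<ge>N. \<forall>n. norm (sum (\<lambda>i. X i x) {m..<n}) < r" by blast
    qed
  qed
qed

section \<open>Bounded centred variables: convergence and exponential moments\<close>

lemma hoeffding_exp_moment:
  assumes [measurable]: "Y \<in> borel_measurable M"
    and "\<And>x. \<bar>Y x\<bar> \<le> c" "expectation Y = 0" "l > 0"
  shows "(\<integral>\<^sup>+x. ennreal (exp (l * Y x)) \<partial>M) \<le> ennreal (exp (l\<^sup>2 / 2 * c\<^sup>2))"
proof -
  \<comment> \<open>Hoeffding's exponent is \<open>l\<^sup>2\<close> times the squared interval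
    width over 8; width \<open>2 * c\<close> gives \<open>l\<^sup>2 / 2 * c\<^sup>2\<close>.\<close>
  interpret interval_bounded_random_variable M Y "-c" c
    using assms(2) by unfold_locales (auto simp: abs_le_iff minus_le_iff)
  show ?thesis
    using Hoeffdings_lemma_nn_integral_0[OF assms(4,3)]
    by (simp add: power2_eq_square mult.assoc mult.commute mult.left_commute)
qed

lemma AE_summable_bounded_indep:
  fixes X :: "nat \<Rightarrow> 'a \<Rightarrow> real"
  assumes indep: "indep_vars (\<lambda>_. borel) X UNIV"
    and bound: "\<And>i x. \<bar>X i x\<bar> \<le> c i"
    and mean: "\<And>i. expectation (X i) = 0"
    and c: "summable (\<lambda>i. (c i)\<^sup>2)"
  shows "AE x in M. summable (\<lambda>i. X i x)"
proof -
  have [measurable]: "X i \<in> borel_measurable M" for i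
    using indep by (auto simp: indep_vars_def)
  have le: "(X i x)\<^sup>2 \<le> (c i)\<^sup>2" for i x
    using bound by (metis abs_ge_zero power2_abs power_mono)
  have sq: "integrable M (\<lambda>x. (X i x)\<^sup>2)" for i
    by (rule integrable_const_bound[where B="(c i)\<^sup>2"]) (auto simp: le)
  show ?thesis
  proof (rule kolmogorov_one_series[OF indep sq mean])
    have "expectation (\<lambda>x. (X i x)\<^sup>2) \<le> (c i)\<^sup>2" for i
      using integral_mono[OF sq integrable_const le] by (simp add: prob_space)
    then show "summable (\<lambda>i. expectation (\<lambda>x. (X i x)\<^sup>2))"
      by (intro summable_comparison_test'[OF c, of 0]) auto
  qed
qed

lemma nn_integral_exp_suminf_indep:
  fixes X :: "nat \<Rightarrow> 'a \<Rightarrow> real"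
  assumes indep: "indep_vars (\<lambda>_. borel) X UNIV"
    and bound: "\<And>i x. \<bar>X i x\<bar> \<le> c i"
    and mean: "\<And>i. expectation (X i) = 0"
    and c: "summable (\<lambda>i. (c i)\<^sup>2)"
    and l: "l > 0"
  shows "(\<integral>\<^sup>+x. ennreal (exp (l * (\<Sum>i. X i x))) \<partial>M) < \<infinity>"
proof -
  have [measurable]: "X i \<in> borel_measurable M" for i
    using indep by (auto simp: indep_vars_def)
  let ?Y = "\<lambda>n x. \<Prod>i<n. ennreal (exp (l * X i x))"
  let ?K = "ennreal (exp (l\<^sup>2 / 2 * (\<Sum>i. (c i)\<^sup>2)))"
  have Y: "?Y n x = ennreal (exp (l * (\<Sum>i<n. X i x)))" for n x
    by (subst prod_ennreal) (auto simp: exp_sum sum_distrib_left)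
  have le: "(\<integral>\<^sup>+x. ?Y n x \<partial>M) \<le> ?K" for n
  proof -
    have "indep_vars (\<lambda>_. borel) (\<lambda>i x. ennreal (exp (l * X i x))) {..<n}"
      by (rule indep_vars_compose2[OF indep_vars_subset[OF indep], of "{..<n}" "\<lambda>_ z. ennreal (exp (l * z))"]) auto
    then have "(\<integral>\<^sup>+x. ?Y n x \<partial>M) = (\<Prod>i<n. \<integral>\<^sup>+x. ennreal (exp (l * X i x)) \<partial>M)"
      by (intro indep_vars_nn_integral) auto
    also have "\<dots> \<le> (\<Prod>i<n. ennreal (exp (l\<^sup>2 / 2 * (c i)\<^sup>2)))"
      by (intro prod_mono_ennreal hoeffding_exp_moment bound mean l) auto
    also have "\<dots> = ennreal (exp (l\<^sup>2 / 2 * (\<Sum>i<n. (c i)\<^sup>2)))"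
      by (subst prod_ennreal) (auto simp: exp_sum sum_distrib_left)
    also have "\<dots> \<le> ?K"
      using sum_le_suminf[OF c, of "{..<n}"] by (intro ennreal_leI) (auto intro!: mult_left_mono)
    finally show ?thesis .
  qed
  \<comment> \<open>Fatou's lemma needs the integrand as a lower limit. This holds where the series
    converges; elsewhere \<open>suminf\<close> has no meaningful value, but that set is
    null.\<close>
  have "AE x in M. ennreal (exp (l * (\<Sum>i. X i x))) = liminf (\<lambda>n. ?Y n x)"
    using AE_summable_bounded_indep[OF indep bound mean c]
  proof eventually_elim
    case (elim x)
    have "(\<lambda>n. ?Y n x) \<longlonglongrightarrow> ennreal (exp (l * (\<Sum>i. X i x)))"
      unfolding Y by (intro tendsto_intros summable_LIMSEQ elim)
    then show ?case by (intro lim_imp_Liminf[symmetric]) auto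
  qed
  then have "(\<integral>\<^sup>+x. ennreal (exp (l * (\<Sum>i. X i x))) \<partial>M) = (\<integral>\<^sup>+x. liminf (\<lambda>n. ?Y n x) \<partial>M)"
    by (rule nn_integral_cong_AE)
  also have "\<dots> \<le> liminf (\<lambda>n. \<integral>\<^sup>+x. ?Y n x \<partial>M)"
    by (rule nn_integral_liminf) measurable
  also have "\<dots> \<le> liminf (\<lambda>n. ?K)"
    by (intro Liminf_mono always_eventually allI le)
  also have "\<dots> = ?K" by (intro Liminf_const) simp
  finally show ?thesis
    by (auto simp: less_top[symmetric] top_unique)
qed

end

subsection \<open>Bernoulli measures\<close>

lemma prob_space_bernoulli_measure: "prob_space (bernoulli_measure r)"
  unfolding bernoulli_measure_def by (intro prob_space_PiM prob_space_measure_pmf)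

lemma space_bernoulli_measure [simp]: "space (bernoulli_measure r) = UNIV"
  by (simp add: bernoulli_measure_def space_PiM)

lemma measurable_case_nat_bernoulli [measurable]:
  "case_nat a \<in> measurable (bernoulli_measure r) (bernoulli_measure r)"
  unfolding bernoulli_measure_def by measurable

lemma measurable_coordinate_bernoulli [measurable]:
  "(\<lambda>x. F (x (i::nat))) \<in> borel_measurable (bernoulli_measure r)"
  unfolding bernoulli_measure_def
  by (rule measurable_compose[OF measurable_component_singleton]) auto

text \<open>Prefixing an independent letter with law \<open>r\<close> leaves the Bernoulli measure
  unchanged, and integrating over that letter is a finite sum. All estimates for the maps
  \<open>case_nat a\<close> come from this identity.\<close>

lemma nn_integral_bernoulli_case_nat:
  fixes r :: "'a::finite pmf"
  assumes F: "F \<in> borel_measurable (bernoulli_measure r)"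
  shows "(\<integral>\<^sup>+x. F x \<partial>bernoulli_measure r) =
    (\<Sum>a\<in>UNIV. ennreal (pmf r a) * (\<integral>\<^sup>+x. F (case_nat a x) \<partial>bernoulli_measure r))"
proof -
  interpret sequence_space "measure_pmf r"
    by unfold_locales
  let ?M = "measure_pmf r"
  note [measurable] = F[unfolded bernoulli_measure_def]
  have "(\<integral>\<^sup>+x. F x \<partial>S) = (\<integral>\<^sup>+x. F x \<partial>distr (?M \<Otimes>\<^sub>M S) S (\<lambda>(s, \<omega>). case_nat s \<omega>))"
    by (simp add: PiM_iter)
  also have "\<dots> = (\<integral>\<^sup>+z. F (case z of (s, \<omega>) \<Rightarrow> case_nat s \<omega>) \<partial>(?M \<Otimes>\<^sub>M S))"
    by (rule nn_integral_distr) measurable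
  also have "\<dots> = (\<integral>\<^sup>+a. (\<integral>\<^sup>+x. F (case_nat a x) \<partial>S) \<partial>?M)"
    by (subst P.nn_integral_fst[symmetric]) (simp_all add: case_prod_beta)
  also have "\<dots> = (\<Sum>a\<in>UNIV. ennreal (pmf r a) * (\<integral>\<^sup>+x. F (case_nat a x) \<partial>S))"
    by (subst nn_integral_measure_pmf_support[of UNIV]) (auto simp: mult.commute)
  finally show ?thesis by (simp add: bernoulli_measure_def)
qed

lemma nn_integral_bernoulli_case_nat_le:
  fixes r :: "'a::finite pmf"
  assumes "F \<in> borel_measurable (bernoulli_measure r)"
  shows "ennreal (pmf r a) * (\<integral>\<^sup>+x. F (case_nat a x) \<partial>bernoulli_measure r)
    \<le> (\<integral>\<^sup>+x. F x \<partial>bernoulli_measure r)"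
  unfolding nn_integral_bernoulli_case_nat[OF assms] by (rule member_le_sum) auto

text \<open>Since the letter has positive mass, the one-letter inequality for an indicator shows
  that the preimage of a null set under prefixing is null.\<close>

lemma AE_bernoulli_case_nat:
  fixes r :: "'a::finite pmf"
  assumes "AE x in bernoulli_measure r. P x" and "a \<in> set_pmf r"
  shows "AE x in bernoulli_measure r. P (case_nat a x)"
proof -
  \<comment> \<open>The set where \<open>P\<close> fails may be non-measurable, so it is covered by
    a measurable null set \<open>N\<close>.\<close>
  from assms(1) obtain N where N: "{x. \<not> P x} \<subseteq> N" "emeasure (bernoulli_measure r) N = 0"
    and [measurable]: "N \<in> sets (bernoulli_measure r)"
    by (auto elim: AE_E)
  have "ennreal (pmf r a) * (\<integral>\<^sup>+x. indicator N (case_nat a x) \<partial>bernoulli_measure r) = 0"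
    using nn_integral_bernoulli_case_nat_le[of "indicator N" r a] N by simp
  moreover have "pmf r a > 0" using assms(2) by (simp add: pmf_positive)
  ultimately have "(\<integral>\<^sup>+x. indicator N (case_nat a x) \<partial>bernoulli_measure r) = (0::ennreal)"
    by simp
  then have "AE x in bernoulli_measure r. indicator N (case_nat a x) = (0::ennreal)"
    by (subst (asm) nn_integral_0_iff_AE) measurable
  then show ?thesis
    by eventually_elim (use N(1) in \<open>auto simp: indicator_eq_0_iff\<close>)
qed

text \<open>Dividing the one-letter inequality by the positive mass of \<open>a\<close> inside
  \<open>ennreal\<close> gives integrability and the bound together.\<close>

lemma integral_bernoulli_case_nat_le:
  fixes r :: "'a::finite pmf" and F :: "(nat \<Rightarrow> 'a) \<Rightarrow> real"
  assumes F: "integrable (bernoulli_measure r) F" "\<And>x. F x \<ge> 0" and a: "a \<in> set_pmf r"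
  shows "integrable (bernoulli_measure r) (\<lambda>x. F (case_nat a x))"
    and "(\<integral>x. F (case_nat a x) \<partial>bernoulli_measure r) \<le> (\<integral>x. F x \<partial>bernoulli_measure r) / pmf r a"
proof -
  note [measurable] = borel_measurable_integrable[OF F(1)]
  have p: "pmf r a > 0" using a by (simp add: pmf_positive)
  have "ennreal (pmf r a) * (\<integral>\<^sup>+x. F (case_nat a x) \<partial>bernoulli_measure r)
      \<le> ennreal (\<integral>x. F x \<partial>bernoulli_measure r)"
    using nn_integral_bernoulli_case_nat_le[of F r a] nn_integral_eq_integral[OF F(1)] F(2) by simp
  then have "ennreal (1 / pmf r a) * (ennreal (pmf r a) * (\<integral>\<^sup>+x. F (case_nat a x) \<partial>bernoulli_measure r))
      \<le> ennreal (1 / pmf r a) * ennreal (\<integral>x. F x \<partial>bernoulli_measure r)"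
    by (rule mult_left_mono) simp
  then have le: "(\<integral>\<^sup>+x. F (case_nat a x) \<partial>bernoulli_measure r)
      \<le> ennreal ((\<integral>x. F x \<partial>bernoulli_measure r) / pmf r a)"
    using p F(2) by (simp add: mult.assoc[symmetric] ennreal_mult[symmetric])
  show int: "integrable (bernoulli_measure r) (\<lambda>x. F (case_nat a x))"
    using le F(2) by (intro integrableI_nonneg) (auto intro: le_less_trans)
  show "(\<integral>x. F (case_nat a x) \<partial>bernoulli_measure r) \<le> (\<integral>x. F x \<partial>bernoulli_measure r) / pmf r a"
    using le nn_integral_eq_integral[OF int] F p by (simp add: ennreal_le_iff)
qed

lemma indep_vars_coordinates_bernoulli:
  fixes r :: "'a::finite pmf" and F :: "nat \<Rightarrow> 'a \<Rightarrow> real"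
  shows "prob_space.indep_vars (bernoulli_measure r) (\<lambda>_. borel) (\<lambda>i x. F i (x i)) UNIV"
proof -
  interpret sequence_space "measure_pmf r"
    by unfold_locales
  \<comment> \<open>Independence is tested on the joint law: the joint map of all coordinates is the
    identity, and each marginal is \<open>measure_pmf r\<close>.\<close>
  have "P.indep_vars (\<lambda>_. measure_pmf r) (\<lambda>i x. x i) UNIV"
    by (subst P.indep_vars_iff_distr_eq_PiM) (auto simp: restrict_UNIV PiM_component distr_id2)
  then have "P.indep_vars (\<lambda>_. borel) (\<lambda>i x. F i (x i)) UNIV"
    by (rule P.indep_vars_compose2) auto
  then show ?thesis by (simp add: bernoulli_measure_def)
qed

lemma integral_coordinate_bernoulli:
  fixes r :: "'a::finite pmf" and F :: "'a \<Rightarrow> real"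
  shows "(\<integral>x. F (x i) \<partial>bernoulli_measure r) = (\<Sum>a\<in>UNIV. pmf r a * F a)"
proof -
  interpret sequence_space "measure_pmf r"
    by unfold_locales
  have "(\<integral>x. F (x i) \<partial>S) = (\<integral>a. F a \<partial>distr S (measure_pmf r) (\<lambda>x. x i))"
    by (rule integral_distr[symmetric]) auto
  also have "\<dots> = (\<integral>a. F a \<partial>measure_pmf r)"
    by (subst PiM_component) auto
  also have "\<dots> = (\<Sum>a\<in>UNIV. pmf r a * F a)"
    by (subst integral_measure_pmf_real[of UNIV]) (auto simp: mult.commute)
  finally show ?thesis by (simp add: bernoulli_measure_def)
qed

subsection \<open>Balanced potentials\<close>

(* Testing the convergence at a point that maximises every factor bounds the positive parts of
   the logarithms; the normalisation prod_a g_i(a) = 1 then bounds the negative parts as well. *)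
lemma balanced_potential_ln_bound:
  assumes "balanced_potential g0 (gs :: nat \<Rightarrow> 'a::finite \<Rightarrow> real) g"
  obtains B where "summable B" "\<And>i a. \<bar>ln (gs i a)\<bar> \<le> B i"
proof -
  have pos: "gs i a > 0" and one: "(\<Prod>a\<in>UNIV. gs i a) = 1"
    and summ: "summable (\<lambda>i. ln (gs i (x i)))" for i a x
    using assms by (auto simp: balanced_potential_def)
  define N where "N = real (card (UNIV :: 'a set))"
  have N: "N \<ge> 1"
    unfolding N_def by (simp add: Suc_leI card_gt_0_iff)
  define m where "m i = (MAX a. ln (gs i a))" for i
  have m: "ln (gs i a) \<le> m i" for i a
    by (simp add: m_def)
  have "\<exists>a. m i = ln (gs i a)" for i
    using Max_in[of "range (\<lambda>a. ln (gs i a))"] unfolding m_def by (metis finite UNIV_not_empty image_is_empty rangeE finite_imageI)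
  then obtain x where x: "\<And>i. m i = ln (gs i (x i))" by metis
  have sum0: "(\<Sum>a\<in>UNIV. ln (gs i a)) = 0" for i
    using ln_prod[of UNIV "gs i"] one[of i] by (simp add: less_imp_neq[OF pos, symmetric])
  have m0: "m i \<ge> 0" for i
  proof -
    have "0 \<le> N * m i"
      using sum_bounded_above[of UNIV "\<lambda>a. ln (gs i a)" "m i"] m sum0 by (simp add: N_def)
    then show ?thesis using N by (simp add: zero_le_mult_iff)
  qed
  show ?thesis
  proof (rule that[of "\<lambda>i. N * m i"])
    show "summable (\<lambda>i. N * m i)"
      using summ[of x] by (intro summable_mult) (simp add: x)
  next
    fix i a
    \<comment> \<open>The logarithms over all letters sum to 0, so the negative of one is the sum of
      the others, each at most \<open>m i\<close>.\<close>
    have "- ln (gs i a) = (\<Sum>b\<in>UNIV - {a}. ln (gs i b))"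
      using sum0[of i] by (subst (asm) sum.remove[of _ a]) auto
    also have "\<dots> \<le> real (card (UNIV - {a})) * m i"
      using m by (intro sum_bounded_above)
    also have "\<dots> \<le> N * m i"
      unfolding N_def by (intro mult_right_mono m0 of_nat_mono card_mono) auto
    finally have "- ln (gs i a) \<le> N * m i" .
    moreover have "ln (gs i a) \<le> N * m i"
      using m[of i a] m0[of i] N mult_right_mono[of 1 N "m i"] by auto
    ultimately show "\<bar>ln (gs i a)\<bar> \<le> N * m i" by auto
  qed
qed

lemma balanced_potential_eq_exp:
  assumes "balanced_potential g0 gs g"
  shows "g x = g0 * exp (\<Sum>i. ln (gs i (x i)))"
proof -
  have "exp (\<Sum>i. ln (gs i (x i))) = (\<Prod>i. exp (ln (gs i (x i))))"
    using assms by (intro prodinf_exp[symmetric]) (auto simp: balanced_potential_def)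
  with assms show ?thesis by (simp add: balanced_potential_def)
qed

text \<open>The summable bounds on the logarithms do not depend on the point, so they bound the
  exponent uniformly.\<close>

lemma balanced_potential_bounded:
  assumes "balanced_potential g0 (gs :: nat \<Rightarrow> 'a::finite \<Rightarrow> real) g"
  obtains C where "\<And>x. g x \<le> C"
proof -
  obtain B where B: "summable B" "\<And>i a. \<bar>ln (gs i a)\<bar> \<le> B i"
    using balanced_potential_ln_bound[OF assms] by blast
  have g0: "g0 > 0" and summ: "\<And>x. summable (\<lambda>i. ln (gs i (x i)))"
    using assms by (auto simp: balanced_potential_def)
  show ?thesis
  proof (rule that)
    have "ln (gs i a) \<le> B i" for i a using B(2)[of i a] by auto
    then show "g x \<le> g0 * exp (\<Sum>i. B i)" for x
      unfolding balanced_potential_eq_exp[OF assms] using g0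
      by (intro mult_left_mono) (auto intro!: suminf_le summ B)
  qed
qed

section \<open>Tail logarithms, that is, the logarithms of the factors of h\<close>

definition tail_log :: "(nat \<Rightarrow> 'a \<Rightarrow> real) \<Rightarrow> nat \<Rightarrow> 'a \<Rightarrow> real" where
  "tail_log gs i a = (\<Sum>j. ln (gs (Suc i + j) a))"

context
  fixes g0 and gs :: "nat \<Rightarrow> 'a::finite \<Rightarrow> real" and g
  assumes balanced: "balanced_potential g0 gs g"
begin

lemma gs_pos: "gs i a > 0"
  using balanced by (simp add: balanced_potential_def)

lemma summable_ln_gs: "summable (\<lambda>i. ln (gs i (x i)))"
  using balanced by (simp add: balanced_potential_def)

lemma summable_ln_gs_letter: "summable (\<lambda>j. ln (gs (k + j) a))"
  using summable_ln_gs[of "\<lambda>_. a"] summable_ignore_initial_segment[of "\<lambda>j. ln (gs j a)" k]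
  by (simp add: add.commute)

lemma prodinf_gs_letter: "(\<Prod>j. gs (k + j) a) = exp (\<Sum>j. ln (gs (k + j) a))"
  using prodinf_exp[OF summable_ln_gs_letter[of k a]] by (simp add: gs_pos)

lemma h_factor_eq_exp: "h_factor gs i a = exp (tail_log gs i a)"
  unfolding h_factor_def tail_log_def by (rule prodinf_gs_letter)

lemma tail_log_Suc: "tail_log gs i a = ln (gs (Suc i) a) + tail_log gs (Suc i) a"
  using suminf_split_head[OF summable_ln_gs_letter[of "Suc i" a]] by (simp add: tail_log_def)

lemma prodinf_gs_eq: "(\<Prod>k. gs k a) = exp (ln (gs 0 a) + tail_log gs 0 a)"
  using prodinf_gs_letter[of 0 a] suminf_split_head[OF summable_ln_gs_letter[of 0 a]]
  by (simp add: tail_log_def)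

lemma h_partial_eq_exp: "h_partial gs x n = ennreal (exp (\<Sum>i<n. tail_log gs i (x i)))"
  unfolding h_partial_def h_factor_eq_exp by (subst prod_ennreal) (auto simp: exp_sum)

lemma h_partial_tendsto:
  assumes "summable (\<lambda>i. tail_log gs i (x i))"
  shows "h_partial gs x \<longlonglongrightarrow> ennreal (exp (\<Sum>i. tail_log gs i (x i)))"
  unfolding h_partial_eq_exp[abs_def] by (intro tendsto_intros summable_LIMSEQ assms)

lemma h_fun_eq_exp:
  assumes "summable (\<lambda>i. tail_log gs i (x i))"
  shows "h_fun gs x = ennreal (exp (\<Sum>i. tail_log gs i (x i)))"
  unfolding h_fun_def by (rule limI[OF h_partial_tendsto[OF assms]])

text \<open>Prefixing moves the letter \<open>x i\<close> to index \<open>Suc i\<close>, where its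
  tail logarithm has lost exactly the term \<open>ln (gs (Suc i) (x i))\<close>. These lost terms
  form the series of logarithms at the prefixed point apart from its first term, so they reappear in
  the second sum on the left.\<close>

lemma tail_log_case_nat:
  assumes "summable (\<lambda>i. tail_log gs i (x i))"
  shows "summable (\<lambda>i. tail_log gs i (case_nat a x i))"
    and "(\<Sum>i. tail_log gs i (case_nat a x i)) + (\<Sum>i. ln (gs i (case_nat a x i))) =
      ln (gs 0 a) + tail_log gs 0 a + (\<Sum>i. tail_log gs i (x i))"
proof -
  let ?y = "case_nat a x"
  note S = summable_ln_gs[of ?y]
  have S': "summable (\<lambda>i. ln (gs (Suc i) (x i)))"
    using S by (subst (asm) summable_Suc_iff[symmetric]) simp
  have eq: "tail_log gs (Suc i) (x i) = tail_log gs i (x i) - ln (gs (Suc i) (x i))" for i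
    using tail_log_Suc[of i "x i"] by simp
  have T': "summable (\<lambda>i. tail_log gs (Suc i) (x i))"
    unfolding eq by (intro summable_diff assms S')
  then show T: "summable (\<lambda>i. tail_log gs i (?y i))"
    by (subst summable_Suc_iff[symmetric]) simp
  have "(\<Sum>i. tail_log gs (Suc i) (x i)) = (\<Sum>i. tail_log gs i (x i)) - (\<Sum>i. ln (gs (Suc i) (x i)))"
    unfolding eq by (rule suminf_diff[symmetric, OF assms S'])
  then show "(\<Sum>i. tail_log gs i (?y i)) + (\<Sum>i. ln (gs i (?y i))) =
      ln (gs 0 a) + tail_log gs 0 a + (\<Sum>i. tail_log gs i (x i))"
    using suminf_split_head[OF T] suminf_split_head[OF S] by simp
qed

(* The shift of indices h_i = g_(i+1) h_(i+1) is what makes h an eigenfunction. *)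
lemma h_fun_case_nat:
  assumes "summable (\<lambda>i. tail_log gs i (x i))"
  shows "enn2real (h_fun gs (case_nat a x)) * g (case_nat a x) =
    g0 * (\<Prod>k. gs k a) * enn2real (h_fun gs x)"
  using tail_log_case_nat[OF assms, of a]
  by (simp add: h_fun_eq_exp assms balanced_potential_eq_exp[OF balanced] prodinf_gs_eq
      exp_add[symmetric] mult.assoc mult.left_commute)

lemma measurable_balanced_potential: "g \<in> borel_measurable (bernoulli_measure r)"
proof -
  have [measurable]: "(\<lambda>x. ln (gs i (x i))) \<in> borel_measurable (bernoulli_measure r)" for i
    by (rule measurable_coordinate_bernoulli)
  show ?thesis
    unfolding balanced_potential_eq_exp[OF balanced, abs_def] by measurable
qed

text \<open>Where the partial products diverge, \<open>lim\<close> takes one fixed value, so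
  measurability holds on the whole space and not just almost everywhere.\<close>

lemma measurable_h_fun: "h_fun gs \<in> borel_measurable (bernoulli_measure r)"
proof -
  have [measurable]: "(\<lambda>x. ennreal (h_factor gs i (x i))) \<in> borel_measurable (bernoulli_measure r)" for i
    by (rule measurable_coordinate_bernoulli)
  show ?thesis
    unfolding h_fun_def[abs_def] h_partial_def[abs_def] by measurable
qed

text \<open>The finite sum over letters commutes with the convergent series over indices. With
  \<open>w\<close> the letter masses, this transfers the centring from the logarithms of the
  potential to those of h.\<close>

lemma mean_tail_log:
  fixes w :: "'a \<Rightarrow> real"
  assumes "\<And>k. (\<Sum>a\<in>UNIV. w a * ln (gs k a)) = 0"
  shows "(\<Sum>a\<in>UNIV. w a * tail_log gs i a) = 0"
proof -
  have "(\<Sum>a\<in>UNIV. w a * tail_log gs i a) = (\<Sum>a\<in>UNIV. \<Sum>j. w a * ln (gs (Suc i + j) a))"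
    unfolding tail_log_def by (intro sum.cong refl suminf_mult[symmetric] summable_ln_gs_letter)
  also have "\<dots> = (\<Sum>j. \<Sum>a\<in>UNIV. w a * ln (gs (Suc i + j) a))"
    by (intro suminf_sum[symmetric] summable_mult summable_ln_gs_letter)
  finally show ?thesis using assms by simp
qed

end

text \<open>The bound is the square root of the largest squared tail over the letters, so its
  squares are summable by the tail condition up to a shift of indices.\<close>

lemma tail_log_bound:
  fixes gs :: "nat \<Rightarrow> 'a::finite \<Rightarrow> real"
  assumes "l2_summable_tails gs"
  obtains c where "summable (\<lambda>i. (c i)\<^sup>2)" "\<And>i a. \<bar>tail_log gs i a\<bar> \<le> c i"
proof -
  define m where "m i = (MAX a. (tail_log gs i a)\<^sup>2)" for i
  have m: "(tail_log gs i a)\<^sup>2 \<le> m i" for i a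
    by (simp add: m_def)
  have m0: "0 \<le> m i" for i
    using m[of i undefined] by (meson order_trans zero_le_power2)
  from assms obtain k where "k > 0"
    and k: "summable (\<lambda>i. MAX a\<in>UNIV. (\<Sum>j. ln (gs (k + i + j) a))\<^sup>2)"
    by (auto simp: l2_summable_tails_def)
  have "(MAX a\<in>UNIV. (\<Sum>j. ln (gs (k + i + j) a))\<^sup>2) = m (i + (k - 1))" for i
  proof -
    \<comment> \<open>\<open>tail_log gs i\<close> starts its series at \<open>Suc i\<close>, so a
      series starting at \<open>k + i\<close> is the tail logarithm of index
      \<open>i + (k - 1)\<close>; this uses \<open>k > 0\<close>.\<close>
    have "Suc (i + (k - 1)) = k + i" using \<open>k > 0\<close> by simp
    then show ?thesis by (simp only: m_def tail_log_def)
  qed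
  with k have "summable m" using summable_iff_shift[of m "k - 1"] by simp
  then show ?thesis
    using m m0 by (intro that[of "\<lambda>i. sqrt (m i)"]) (auto intro: real_le_rsqrt)
qed

subsection \<open>The Ruelle operator\<close>

text \<open>A crude substitute for convexity: replace every term by the largest one, whose power is
  itself a summand on the right.\<close>

lemma sum_powr_le_sum:
  fixes t :: "'b \<Rightarrow> real"
  assumes "finite A" "\<And>a. a \<in> A \<Longrightarrow> t a \<ge> 0" "q \<ge> 0"
  shows "(\<Sum>a\<in>A. t a) powr q \<le> real (card A) powr q * (\<Sum>a\<in>A. t a powr q)"
proof (cases "A = {}")
  case False
  define m where "m = Max (t ` A)"
  have "m \<in> t ` A" using assms False unfolding m_def by (intro Max_in) auto
  then obtain a where a: "a \<in> A" "m = t a" by auto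
  have "(\<Sum>a\<in>A. t a) \<le> real (card A) * m"
    using assms unfolding m_def by (intro sum_bounded_above) auto
  then have "(\<Sum>a\<in>A. t a) powr q \<le> (real (card A) * m) powr q"
    using assms by (intro powr_mono2 sum_nonneg) auto
  also have "\<dots> = real (card A) powr q * t a powr q"
    using a assms by (simp add: powr_mult)
  also have "\<dots> \<le> real (card A) powr q * (\<Sum>a\<in>A. t a powr q)"
    using assms a by (intro mult_left_mono member_le_sum) auto
  finally show ?thesis .
qed simp

lemma norm_ruelle_operator_le:
  fixes f :: "(nat \<Rightarrow> 'a::finite) \<Rightarrow> real" and \<phi> :: "(nat \<Rightarrow> 'a) \<Rightarrow> 'k::real_normed_field"
  assumes "\<And>y. exp (f y) \<le> C"
  shows "norm (ruelle_operator f \<phi> x) \<le> C * (\<Sum>a\<in>UNIV. norm (\<phi> (case_nat a x)))"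
proof -
  have "norm (ruelle_operator f \<phi> x) \<le> (\<Sum>a\<in>UNIV. norm (\<phi> (case_nat a x) * of_real (exp (f (case_nat a x)))))"
    unfolding ruelle_operator_eq_sum_letters by (rule norm_sum)
  also have "\<dots> \<le> (\<Sum>a\<in>UNIV. norm (\<phi> (case_nat a x)) * C)"
    using assms by (intro sum_mono) (auto simp: norm_mult intro!: mult_left_mono)
  finally show ?thesis by (simp add: sum_distrib_left mult.commute)
qed

lemma measurable_ruelle_operator [measurable]:
  fixes f :: "(nat \<Rightarrow> 'a::finite) \<Rightarrow> real"
    and \<phi> :: "(nat \<Rightarrow> 'a) \<Rightarrow> 'k::{real_normed_field, second_countable_topology}"
  assumes [measurable]: "f \<in> borel_measurable (bernoulli_measure r)"
    "\<phi> \<in> borel_measurable (bernoulli_measure r)"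
  shows "ruelle_operator f \<phi> \<in> borel_measurable (bernoulli_measure r)"
  unfolding ruelle_operator_eq_sum_letters[abs_def] by measurable

context
  fixes f :: "(nat \<Rightarrow> 'a::finite) \<Rightarrow> real" and C :: real and r :: "'a pmf"
  assumes f [measurable]: "f \<in> borel_measurable (bernoulli_measure r)"
    and C: "\<And>y. exp (f y) \<le> C"
    and full: "set_pmf r = UNIV"
begin

text \<open>Every letter has positive mass, so the exceptional set stays null under each prefix map,
  and there are finitely many letters.\<close>

lemma ruelle_operator_cong_AE:
  assumes "AE x in bernoulli_measure r. \<phi> x = \<psi> x"
  shows "AE x in bernoulli_measure r. ruelle_operator f \<phi> x = ruelle_operator f \<psi> x"
proof -
  have "AE x in bernoulli_measure r. \<forall>a\<in>UNIV. \<phi> (case_nat a x) = \<psi> (case_nat a x)"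
    using AE_bernoulli_case_nat[OF assms] full by (intro AE_finite_allI) auto
  then show ?thesis
    by eventually_elim (simp add: ruelle_operator_eq_sum_letters)
qed

text \<open>An almost sure bound survives prefixing any letter, and the operator adds one such term
  per letter with weight at most \<open>C\<close>.\<close>

lemma ruelle_operator_Linfinity:
  fixes \<phi> :: "(nat \<Rightarrow> 'a) \<Rightarrow> 'k::{real_normed_field, second_countable_topology}"
  assumes "\<phi> \<in> Lp_space (bernoulli_measure r) \<infinity>"
  shows "ruelle_operator f \<phi> \<in> Lp_space (bernoulli_measure r) \<infinity>"
    and "Lp_norm (bernoulli_measure r) \<infinity> (ruelle_operator f \<phi>)
      \<le> C * real (card (UNIV :: 'a set)) * Lp_norm (bernoulli_measure r) \<infinity> \<phi>"
proof -
  let ?M = "bernoulli_measure r" and ?N = "real (card (UNIV :: 'a set))"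
  have [measurable]: "\<phi> \<in> borel_measurable ?M"
    and fin: "esssup ?M (\<lambda>x. ennreal (norm (\<phi> x))) < \<infinity>"
    using assms by (auto simp: Lp_space_def)
  have C0: "C > 0" using C[of undefined] exp_gt_zero[of "f undefined"] by linarith
  define s where "s = enn2real (esssup ?M (\<lambda>x. ennreal (norm (\<phi> x))))"
  have s: "esssup ?M (\<lambda>x. ennreal (norm (\<phi> x))) = ennreal s" "s \<ge> 0"
    using fin by (auto simp: s_def)
  have "AE x in ?M. norm (\<phi> x) \<le> s"
    using esssup_AE[where M="?M" and f="\<lambda>x. ennreal (norm (\<phi> x))"]
    unfolding s by eventually_elim (use s(2) in simp)
  then have "AE x in ?M. norm (\<phi> (case_nat a x)) \<le> s" for a
    by (rule AE_bernoulli_case_nat) (simp add: full)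
  then have "AE x in ?M. \<forall>a\<in>UNIV. norm (\<phi> (case_nat a x)) \<le> s"
    by (intro AE_finite_allI) auto
  then have "AE x in ?M. ennreal (norm (ruelle_operator f \<phi> x)) \<le> ennreal (C * ?N * s)"
  proof eventually_elim
    case (elim x)
    have "(\<Sum>a\<in>UNIV. norm (\<phi> (case_nat a x))) \<le> ?N * s"
      using elim by (intro sum_bounded_above) auto
    then have "C * (\<Sum>a\<in>UNIV. norm (\<phi> (case_nat a x))) \<le> C * ?N * s"
      using C0 by (simp add: mult.assoc)
    then show ?case
      using norm_ruelle_operator_le[where f = f, OF C, where \<phi> = \<phi> and x = x] by (intro ennreal_leI) linarith
  qed
  then have le: "esssup ?M (\<lambda>x. ennreal (norm (ruelle_operator f \<phi> x))) \<le> ennreal (C * ?N * s)"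
    by (intro esssup_I) auto
  then show "ruelle_operator f \<phi> \<in> Lp_space ?M \<infinity>"
    by (auto simp: Lp_space_def intro: le_less_trans)
  show "Lp_norm ?M \<infinity> (ruelle_operator f \<phi>) \<le> C * ?N * Lp_norm ?M \<infinity> \<phi>"
    using enn2real_mono[OF le] s(2) C0 by (simp add: Lp_norm_def s_def[symmetric])
qed

text \<open>\<open>K\<close> collects the pointwise factor from bounding the power of a sum and the
  loss \<open>1 / pmf r a\<close> of each prefix map.\<close>

lemma ruelle_operator_Lp:
  fixes \<phi> :: "(nat \<Rightarrow> 'a) \<Rightarrow> 'k::{real_normed_field, second_countable_topology}"
  assumes \<phi>: "\<phi> \<in> Lp_space (bernoulli_measure r) p" and p: "1 \<le> p" "p < \<infinity>"
  defines "K \<equiv> (C * real (card (UNIV :: 'a set))) powr enn2real p * (\<Sum>a\<in>UNIV. 1 / pmf r a)"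
  shows "ruelle_operator f \<phi> \<in> Lp_space (bernoulli_measure r) p"
    and "Lp_norm (bernoulli_measure r) p (ruelle_operator f \<phi>)
      \<le> K powr (1 / enn2real p) * Lp_norm (bernoulli_measure r) p \<phi>"
proof -
  let ?M = "bernoulli_measure r" and ?N = "real (card (UNIV :: 'a set))"
  define q where "q = enn2real p"
  have q: "q \<ge> 1" using enn2real_mono[of 1 p] p by (simp add: q_def)
  have [measurable]: "\<phi> \<in> borel_measurable ?M"
    and int: "integrable ?M (\<lambda>x. norm (\<phi> x) powr q)"
    using \<phi> p by (auto simp: Lp_space_def q_def)
  have C0: "C > 0" using C[of undefined] exp_gt_zero[of "f undefined"] by linarith
  let ?I = "\<integral>x. norm (\<phi> x) powr q \<partial>?M"
  let ?R = "\<lambda>x. (C * ?N) powr q * (\<Sum>a\<in>UNIV. norm (\<phi> (case_nat a x)) powr q)"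
  have le: "norm (ruelle_operator f \<phi> x) powr q \<le> ?R x" for x
  proof -
    have "norm (ruelle_operator f \<phi> x) powr q \<le> (C * (\<Sum>a\<in>UNIV. norm (\<phi> (case_nat a x)))) powr q"
      using q by (intro powr_mono2 norm_ruelle_operator_le C) auto
    also have "\<dots> = C powr q * (\<Sum>a\<in>UNIV. norm (\<phi> (case_nat a x))) powr q"
      by (rule powr_mult)
    also have "\<dots> \<le> C powr q * (?N powr q * (\<Sum>a\<in>UNIV. norm (\<phi> (case_nat a x)) powr q))"
      using q by (intro mult_left_mono sum_powr_le_sum) auto
    also have "\<dots> = ?R x" using C0 by (simp add: powr_mult)
    finally show ?thesis .
  qed
  have inta: "integrable ?M (\<lambda>x. norm (\<phi> (case_nat a x)) powr q)"
    and lea: "(\<integral>x. norm (\<phi> (case_nat a x)) powr q \<partial>?M) \<le> ?I / pmf r a" for a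
    using integral_bernoulli_case_nat_le[OF int, of a] full by auto
  have intR: "integrable ?M ?R" using inta by auto
  have intL: "integrable ?M (\<lambda>x. norm (ruelle_operator f \<phi> x) powr q)"
    by (rule Bochner_Integration.integrable_bound[OF intR])
      (auto intro!: AE_I2 order_trans[OF le abs_ge_self] simp del: abs_mult abs_sum_abs)
  then show "ruelle_operator f \<phi> \<in> Lp_space ?M p"
    using p by (auto simp: Lp_space_def q_def)
  have "(\<integral>x. norm (ruelle_operator f \<phi> x) powr q \<partial>?M) \<le> (\<integral>x. ?R x \<partial>?M)"
    by (intro integral_mono intL intR le)
  also have "\<dots> = (C * ?N) powr q * (\<Sum>a\<in>UNIV. \<integral>x. norm (\<phi> (case_nat a x)) powr q \<partial>?M)"
    using inta by simp
  also have "\<dots> \<le> (C * ?N) powr q * (\<Sum>a\<in>UNIV. ?I / pmf r a)"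
    by (intro mult_left_mono sum_mono lea) auto
  also have "\<dots> = K * ?I"
    by (simp add: K_def q_def[symmetric] sum_distrib_right)
  finally have "(\<integral>x. norm (ruelle_operator f \<phi> x) powr q \<partial>?M) powr (1 / q) \<le> (K * ?I) powr (1 / q)"
    using q by (intro powr_mono2) auto
  also have "\<dots> = K powr (1 / q) * ?I powr (1 / q)"
    by (rule powr_mult)
  finally show "Lp_norm ?M p (ruelle_operator f \<phi>) \<le> K powr (1 / enn2real p) * Lp_norm ?M p \<phi>"
    using p by (auto simp: Lp_norm_def q_def)
qed

lemma ruelle_operator_bounded_linear:
  assumes "1 \<le> p"
  shows "defines_bounded_linear_operator_on_Lp (bernoulli_measure r) p
    (ruelle_operator f :: _ \<Rightarrow> _ \<Rightarrow> 'k::{real_normed_field, second_countable_topology})"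
proof -
  let ?M = "bernoulli_measure r" and ?L = "ruelle_operator f :: _ \<Rightarrow> _ \<Rightarrow> 'k"
  have "\<exists>K. \<forall>\<phi>\<in>Lp_space ?M p. ?L \<phi> \<in> Lp_space ?M p \<and> Lp_norm ?M p (?L \<phi>) \<le> K * Lp_norm ?M p \<phi>"
  proof (cases "p = \<infinity>")
    case True
    then show ?thesis using ruelle_operator_Linfinity by blast
  next
    case False
    then have "p < \<infinity>" by (simp add: less_top)
    then show ?thesis using ruelle_operator_Lp[OF _ assms] by blast
  qed
  moreover have "?L (\<lambda>y. \<phi> y + \<psi> y) x = ?L \<phi> x + ?L \<psi> x" for \<phi> \<psi> x
    by (simp add: ruelle_operator_eq_sum_letters sum.distrib distrib_right)
  moreover have "?L (\<lambda>y. c * \<phi> y) x = c * ?L \<phi> x" for c \<phi> x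
    by (simp add: ruelle_operator_eq_sum_letters sum_distrib_left mult.assoc)
  ultimately show ?thesis
    unfolding defines_bounded_linear_operator_on_Lp_def by (auto simp: ruelle_operator_cong_AE)
qed

end

section \<open>Boundedness on L^p and the eigenfunction\<close>

theorem theorem5p1:
  fixes g0 :: real
    and gs :: "nat \<Rightarrow> 'a::finite \<Rightarrow> real"
    and f :: "(nat \<Rightarrow> 'a) \<Rightarrow> real"
    and L :: "((nat \<Rightarrow> 'a) \<Rightarrow> 'k::{real_normed_field, banach, second_countable_topology})
              \<Rightarrow> (nat \<Rightarrow> 'a) \<Rightarrow> 'k"
  assumes "balanced_potential g0 gs (\<lambda>x. exp (f x))"
    and "L = ruelle_operator f"
  shows
    "(\<forall>\<rho>0 :: 'a pmf. set_pmf \<rho>0 = UNIV \<longrightarrow>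
        (\<forall>p\<ge>1. defines_bounded_linear_operator_on_Lp (bernoulli_measure \<rho>0) p L)) \<and>
     (l2_summable_tails gs \<longrightarrow>
        (\<forall>\<rho>0 :: 'a pmf. (\<forall>k. (\<Sum>a\<in>UNIV. pmf \<rho>0 a * ln (gs k a)) = 0) \<longrightarrow>
           (AE x in bernoulli_measure \<rho>0.
              convergent (h_partial gs x) \<and> 0 < h_fun gs x \<and> h_fun gs x < \<infinity>) \<and>
           (\<forall>p. 1 \<le> p \<and> p < \<infinity> \<longrightarrow>
              (\<lambda>x. of_real (enn2real (h_fun gs x)) :: 'k) \<in> Lp_space (bernoulli_measure \<rho>0) p \<and>
              Lp_eigenfunction (bernoulli_measure \<rho>0) p L
                (of_real (eigenvalue g0 gs)) (\<lambda>x. of_real (enn2real (h_fun gs x))))))"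
proof (intro conjI impI allI; (elim conjE)?)
  fix \<rho>0 :: "'a pmf" and p :: ennreal
  assume "set_pmf \<rho>0 = UNIV" "p \<ge> 1"
  moreover obtain C where "\<And>x. exp (f x) \<le> C"
    using balanced_potential_bounded[OF assms(1)] by blast
  \<comment> \<open>Measurability is known for the potential \<open>exp (f x)\<close>; the logarithm
    recovers it for \<open>f\<close>.\<close>
  moreover have "(\<lambda>x. ln (exp (f x))) \<in> borel_measurable (bernoulli_measure \<rho>0)"
    using measurable_balanced_potential[OF assms(1)] by measurable
  ultimately show "defines_bounded_linear_operator_on_Lp (bernoulli_measure \<rho>0) p L"
    unfolding assms(2) by (intro ruelle_operator_bounded_linear) auto
next
  fix \<rho>0 :: "'a pmf"
  assume tails: "l2_summable_tails gs"
    and mean: "\<forall>k. (\<Sum>a\<in>UNIV. pmf \<rho>0 a * ln (gs k a)) = 0"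
  let ?M = "bernoulli_measure \<rho>0"
  interpret prob_space ?M by (rule prob_space_bernoulli_measure)
  let ?X = "\<lambda>i (x :: nat \<Rightarrow> 'a). tail_log gs i (x i)"
  let ?h = "\<lambda>x. of_real (enn2real (h_fun gs x)) :: 'k"
  obtain c where c: "summable (\<lambda>i. (c i)\<^sup>2)" "\<And>i a. \<bar>tail_log gs i a\<bar> \<le> c i"
    using tail_log_bound[OF tails] by blast
  have indep: "indep_vars (\<lambda>_. borel) ?X UNIV"
    by (rule indep_vars_coordinates_bernoulli)
  have mean_X: "expectation (?X i) = 0" for i
    using mean by (simp add: integral_coordinate_bernoulli mean_tail_log[OF assms(1)])
  have conv: "AE x in ?M. summable (\<lambda>i. ?X i x)"
    by (rule AE_summable_bounded_indep[OF indep c(2) mean_X c(1)])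
  \<comment> \<open>Where the series of tail logarithms converges, h is the exponential of a real
    number, hence positive and finite.\<close>
  show "AE x in ?M. convergent (h_partial gs x) \<and> 0 < h_fun gs x \<and> h_fun gs x < \<infinity>"
    using conv by eventually_elim
      (auto simp: h_fun_eq_exp[OF assms(1)] convergent_def intro: h_partial_tendsto[OF assms(1)])
  note [measurable] = measurable_h_fun[OF assms(1), of \<rho>0]
  fix p :: ennreal
  assume p: "1 \<le> p" "p < \<infinity>"
  define q where "q = enn2real p"
  have q: "q \<ge> 1" using enn2real_mono[of 1 p] p by (simp add: q_def)
  \<comment> \<open>The q-th power of h is almost surely the exponential of \<open>q\<close> times
    the series, so the exponential moment bound applies with \<open>l = q\<close>.\<close>
  have "AE x in ?M. ennreal (norm (?h x) powr q) = ennreal (exp (q * (\<Sum>i. ?X i x)))"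
    using conv by eventually_elim (simp add: h_fun_eq_exp[OF assms(1)] powr_def)
  then have "(\<integral>\<^sup>+x. ennreal (norm (?h x) powr q) \<partial>?M) = (\<integral>\<^sup>+x. ennreal (exp (q * (\<Sum>i. ?X i x))) \<partial>?M)"
    by (rule nn_integral_cong_AE)
  also have "\<dots> < \<infinity>"
    using q by (intro nn_integral_exp_suminf_indep[OF indep c(2) mean_X c(1)]) auto
  finally have "integrable ?M (\<lambda>x. norm (?h x) powr q)"
    by (intro integrableI_nonneg) auto
  then show h: "?h \<in> Lp_space ?M p"
    using p by (auto simp: Lp_space_def q_def)
  \<comment> \<open>Convergence at \<open>x\<close> alone yields the identity at every preimage, so
    the equation holds wherever the series at \<open>x\<close> converges.\<close>
  have "AE x in ?M. L ?h x = of_real (eigenvalue g0 gs) * ?h x"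
    using conv
  proof eventually_elim
    case (elim x)
    have "L ?h x = of_real (\<Sum>a\<in>UNIV. enn2real (h_fun gs (case_nat a x)) * exp (f (case_nat a x)))"
      by (simp add: assms(2) ruelle_operator_eq_sum_letters)
    also have "\<dots> = of_real (eigenvalue g0 gs * enn2real (h_fun gs x))"
      unfolding h_fun_case_nat[OF assms(1) elim]
      by (simp add: eigenvalue_def sum_distrib_left sum_distrib_right)
    finally show ?case by simp
  qed
  moreover have "\<not> (AE x in ?M. ?h x = 0)"
  proof
    assume "AE x in ?M. ?h x = 0"
    with conv have "AE x in ?M. False"
      by eventually_elim (simp add: h_fun_eq_exp[OF assms(1)])
    then show False by simp
  qed
  ultimately show "Lp_eigenfunction ?M p L (of_real (eigenvalue g0 gs)) ?h"
    using h by (simp add: Lp_eigenfunction_def)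
qed

end
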